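(* Let $\Omega\subset\mathbb{C}$ be open and connected, and let $\mathcal{E}_1$ and $\mathcal{E}_2$ be Hermitian holomorphic bundles over $\Omega$ of rank $n$ and $m$, respectively. Then for all $i,j\ge0$, $$\mathcal{K}_{\mathcal{E}_1\otimes\mathcal{E}_2,\,z^i\overline z^j}=\mathcal{K}_{\mathcal{E}_1,\,z^i\overline z^j}\otimes I_m+I_n\otimes\mathcal{K}_{\mathcal{E}_2,\,z^i\overline z^j}.$$
   Context: The curvature of a Hermitian holomorphic bundle $\mathcal{E}$ of rank $n$, with respect to a holomorphic frame $\{\gamma_1,\dots,\gamma_n\}$ with Gram matrix $h(w)=(\langle\gamma_j(w),\gamma_i(w)\rangle)_{i,j}$, is the matrix $\mathcal{K}_{\mathcal{E}}(w)=-\frac{\partial}{\partial\overline w}\big(h^{-1}\frac{\partial h}{\partial w}\big)$, regarded as a bundle map. For a $C^\infty$ bundle map $\phi$ of $\mathcal{E}$, written as a matrix in the holomorphic frame, the covariant derivatives are $\phi_{\overline z}=\frac{\partial}{\partial\overline w}\phi$ and $\phi_z=\frac{\partial}{\partial w}\phi+[h^{-1}\frac{\partial}{\partial w}h,\phi]$. $\mathcal{K}_{\mathcal{E},z^i\overline z^j}$ is obtained from $\mathcal{K}_{\mathcal{E}}$ by $i$ covariant differentiations in $z$ and $j$ in $\overline z$ (performed in the same order for all the bundles involved). The fibres of each $\mathcal{E}_l$ ($l=1,2$) are subspaces of a Hilbert space with the inherited inner product; matrices are taken with respect to holomorphic frames $\{e^1_s\}_{s=1}^n$ of $\mathcal{E}_1$,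 $\{e^2_t\}_{t=1}^m$ of $\mathcal{E}_2$ and the frame $\{e^1_s\otimes e^2_t\}$ of $\mathcal{E}_1\otimes\mathcal{E}_2$ (with the tensor product Hermitian structure). $I_k$ is the $k\times k$ identity matrix. *)

theory Defs
  imports "HOL-Analysis.Analysis"
begin

section \<open>Complex Hilbert spaces\<close>

(* The inner product is linear in the first and conjugate linear in the second argument,
   so that the Gram matrix (<gamma_j, gamma_i>)_{i,j} represents the metric on column
   vectors of coordinates.  Positive definiteness is part of cinner_self. *)
class complex_hilbert = banach +
  fixes scaleC :: "complex \<Rightarrow> 'a \<Rightarrow> 'a" (infixr \<open>*\<^sub>C\<close> 75)
    and cinner :: "'a \<Rightarrow> 'a \<Rightarrow> complex"
  assumes scaleC_of_real: "complex_of_real r *\<^sub>C x = r *\<^sub>R x"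
    and scaleC_add_right: "c *\<^sub>C (x + y) = c *\<^sub>C x + c *\<^sub>C y"
    and scaleC_add_left: "(c + d) *\<^sub>C x = c *\<^sub>C x + d *\<^sub>C x"
    and scaleC_scaleC: "c *\<^sub>C d *\<^sub>C x = (c * d) *\<^sub>C x"
    and cinner_commute: "cinner x y = cnj (cinner y x)"
    and cinner_add_left: "cinner (x + y) z = cinner x z + cinner y z"
    and cinner_scaleC_left: "cinner (c *\<^sub>C x) y = c * cinner x y"
    and cinner_self: "cinner x x = complex_of_real ((norm x)\<^sup>2)"

lemma scaleC_one: "1 *\<^sub>C x = (x :: 'a::complex_hilbert)"
  using scaleC_of_real[of 1 x] by simp

interpretation cvec: vector_space "scaleC :: complex \<Rightarrow> 'a \<Rightarrow> 'a::complex_hilbert"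
  by unfold_locales
    (simp_all add: scaleC_add_right scaleC_add_left scaleC_scaleC scaleC_one)

(* (H, T) is a model of the Hilbert space tensor product of the domains of T,
   with T x y in the role of the simple tensor of x and y; such a model is unique up to a
   unitary map respecting simple tensors. *)
definition hilbert_tensor_product ::
    "('a::complex_hilbert \<Rightarrow> 'b::complex_hilbert \<Rightarrow> 'c::complex_hilbert) \<Rightarrow> bool" where
  "hilbert_tensor_product T \<longleftrightarrow>
     (\<forall>x x' y. T (x + x') y = T x y + T x' y) \<and>
     (\<forall>x y y'. T x (y + y') = T x y + T x y') \<and>
     (\<forall>c x y. T (c *\<^sub>C x) y = c *\<^sub>C T x y) \<and>
     (\<forall>c x y. T x (c *\<^sub>C y) = c *\<^sub>C T x y) \<and>
     (\<forall>x y x' y'. cinner (T x y) (T x' y') = cinner x x' * cinner y y') \<and>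
     closure (cvec.span (range (\<lambda>(x, y). T x y))) = UNIV"


section \<open>Hermitian holomorphic bundles\<close>

definition vholomorphic_on :: "(complex \<Rightarrow> 'a::complex_hilbert) \<Rightarrow> complex set \<Rightarrow> bool" where
  "vholomorphic_on f U \<longleftrightarrow>
     (\<forall>z\<in>U. \<exists>f'. (f has_derivative (\<lambda>h. h *\<^sub>C f')) (at z within U))"

(* A bundle is given by its family of fibres E w. *)
definition holomorphic_frame ::
    "'i set \<Rightarrow> complex set \<Rightarrow> (complex \<Rightarrow> 'a::complex_hilbert set) \<Rightarrow> ('i \<Rightarrow> complex \<Rightarrow> 'a) \<Rightarrow> bool"
  where
  "holomorphic_frame I U E \<gamma> \<longleftrightarrow>
     (\<forall>s\<in>I. vholomorphic_on (\<gamma> s) U) \<and>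
     (\<forall>w\<in>U. inj_on (\<lambda>s. \<gamma> s w) I \<and>
            cvec.independent ((\<lambda>s. \<gamma> s w) ` I) \<and>
            cvec.span ((\<lambda>s. \<gamma> s w) ` I) = E w)"

definition hermitian_holomorphic_bundle ::
    "complex set \<Rightarrow> nat \<Rightarrow> (complex \<Rightarrow> 'a::complex_hilbert set) \<Rightarrow> bool" where
  "hermitian_holomorphic_bundle \<Omega> n E \<longleftrightarrow>
     (\<forall>w\<^sub>0\<in>\<Omega>. \<exists>U \<gamma>. open U \<and> w\<^sub>0 \<in> U \<and> U \<subseteq> \<Omega> \<and> holomorphic_frame {..<n} U E \<gamma>)"

definition tensor_bundle ::
    "('a \<Rightarrow> 'b \<Rightarrow> 'c::complex_hilbert) \<Rightarrow> (complex \<Rightarrow> 'a::complex_hilbert set) \<Rightarrow>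
     (complex \<Rightarrow> 'b::complex_hilbert set) \<Rightarrow> complex \<Rightarrow> 'c set" where
  "tensor_bundle T E\<^sub>1 E\<^sub>2 w = cvec.span {T x y | x y. x \<in> E\<^sub>1 w \<and> y \<in> E\<^sub>2 w}"

definition tensor_frame ::
    "('a \<Rightarrow> 'b \<Rightarrow> 'c) \<Rightarrow> ('i \<Rightarrow> complex \<Rightarrow> 'a) \<Rightarrow> ('j \<Rightarrow> complex \<Rightarrow> 'b) \<Rightarrow>
     'i \<times> 'j \<Rightarrow> complex \<Rightarrow> 'c" where
  "tensor_frame T e\<^sub>1 e\<^sub>2 = (\<lambda>(s, t) w. T (e\<^sub>1 s w) (e\<^sub>2 t w))"


section \<open>Curvature and its covariant derivatives in a holomorphic frame\<close>

definition partial_x :: "(complex \<Rightarrow> complex) \<Rightarrow> complex \<Rightarrow> complex" where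
  "partial_x f w = vector_derivative (\<lambda>t::real. f (w + of_real t)) (at 0)"

definition partial_y :: "(complex \<Rightarrow> complex) \<Rightarrow> complex \<Rightarrow> complex" where
  "partial_y f w = vector_derivative (\<lambda>t::real. f (w + \<i> * of_real t)) (at 0)"

definition mat_dw :: "(complex \<Rightarrow> complex^'n^'m) \<Rightarrow> complex \<Rightarrow> complex^'n^'m" where
  "mat_dw F w =
     (\<chi> i j. (partial_x (\<lambda>v. F v $ i $ j) w - \<i> * partial_y (\<lambda>v. F v $ i $ j) w) / 2)"

definition mat_dwbar :: "(complex \<Rightarrow> complex^'n^'m) \<Rightarrow> complex \<Rightarrow> complex^'n^'m" where
  "mat_dwbar F w =
     (\<chi> i j. (partial_x (\<lambda>v. F v $ i $ j) w + \<i> * partial_y (\<lambda>v. F v $ i $ j) w) / 2)"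

definition gram :: "('n \<Rightarrow> complex \<Rightarrow> 'a::complex_hilbert) \<Rightarrow> complex \<Rightarrow> complex^'n^'n" where
  "gram \<gamma> w = (\<chi> i j. cinner (\<gamma> j w) (\<gamma> i w))"

definition connection_matrix ::
    "('n::finite \<Rightarrow> complex \<Rightarrow> 'a::complex_hilbert) \<Rightarrow> complex \<Rightarrow> complex^'n^'n" where
  "connection_matrix \<gamma> w = matrix_inv (gram \<gamma> w) ** mat_dw (gram \<gamma>) w"

definition curvature ::
    "('n::finite \<Rightarrow> complex \<Rightarrow> 'a::complex_hilbert) \<Rightarrow> complex \<Rightarrow> complex^'n^'n" where
  "curvature \<gamma> w = - mat_dwbar (connection_matrix \<gamma>) w"

datatype direction = Dz | Dzbar

primrec cov_deriv ::
    "('n::finite \<Rightarrow> complex \<Rightarrow> 'a::complex_hilbert) \<Rightarrow> direction \<Rightarrow>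
     (complex \<Rightarrow> complex^'n^'n) \<Rightarrow> complex \<Rightarrow> complex^'n^'n" where
  "cov_deriv \<gamma> Dz \<phi> =
     (\<lambda>w. mat_dw \<phi> w + (connection_matrix \<gamma> w ** \<phi> w - \<phi> w ** connection_matrix \<gamma> w))"
| "cov_deriv \<gamma> Dzbar \<phi> = mat_dwbar \<phi>"

(* Covariant derivatives in z and zbar do not commute, so iterated derivatives are indexed by
   words of directions; the last letter is applied first. *)
definition curvature_deriv ::
    "('n::finite \<Rightarrow> complex \<Rightarrow> 'a::complex_hilbert) \<Rightarrow> direction list \<Rightarrow>
     complex \<Rightarrow> complex^'n^'n" where
  "curvature_deriv \<gamma> ds = foldr (cov_deriv \<gamma>) ds (curvature \<gamma>)"

definition derivative_orders :: "nat \<Rightarrow> nat \<Rightarrow> direction list set" where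
  "derivative_orders i j = {ds. count_list ds Dz = i \<and> count_list ds Dzbar = j}"

definition kronecker ::
    "complex^'c^'r \<Rightarrow> complex^'d^'s \<Rightarrow> complex^('c \<times> 'd)^('r \<times> 's)" (infixl \<open>\<otimes>\<^sub>K\<close> 70)
  where "A \<otimes>\<^sub>K B = (\<chi> p q. A $ fst p $ fst q * B $ snd p $ snd q)"


section \<open>The frame of simple tensors\<close>

lemma cinner_eq_zeroD: "cinner x x = 0 \<Longrightarrow> x = (0 :: 'a::complex_hilbert)"
  by (simp add: cinner_self)

lemma cinner_zero_left: "cinner 0 y = 0" for y :: "'a::complex_hilbert"
  using cinner_scaleC_left[of 0 0 y] by simp

lemma cinner_sum_left: "cinner (sum f A) y = (\<Sum>a\<in>A. cinner (f a) y)"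
  for y :: "'a::complex_hilbert"
  by (induction A rule: infinite_finite_induct)
    (simp_all add: cinner_zero_left cinner_add_left)

lemma frame_zero_combination:
  fixes g :: "'i \<Rightarrow> 'a::complex_hilbert"
  assumes "finite I" "inj_on g I" "cvec.independent (g ` I)"
    and "(\<Sum>s\<in>I. c s *\<^sub>C g s) = 0" "s \<in> I"
  shows "c s = 0"
proof -
  let ?c = "\<lambda>v. c (the_inv_into I g v)"
  have "(\<Sum>v\<in>g ` I. ?c v *\<^sub>C v) = (\<Sum>s\<in>I. c s *\<^sub>C g s)"
    using assms(2) by (simp add: sum.reindex the_inv_into_f_f)
  then have "?c (g s) = 0"
    using cvec.independentD[OF assms(3) _ subset_refl, of ?c "g s"] assms by simp
  then show ?thesis
    using assms by (simp add: the_inv_into_f_f)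
qed

lemma frame_of_zero_combination:
  fixes g :: "'i \<Rightarrow> 'a::complex_hilbert"
  assumes "finite I"
    and zero: "\<And>c. (\<Sum>s\<in>I. c s *\<^sub>C g s) = 0 \<Longrightarrow> \<forall>s\<in>I. c s = 0"
  shows "inj_on g I" "cvec.independent (g ` I)"
proof -
  show inj: "inj_on g I"
  proof (rule inj_onI, rule ccontr)
    fix s t assume st: "s \<in> I" "t \<in> I" "g s = g t" "s \<noteq> t"
    let ?c = "\<lambda>u. if u = s then 1 else if u = t then - 1 else 0 :: complex"
    have "(\<Sum>u\<in>I. ?c u *\<^sub>C g u) = (\<Sum>u\<in>{s, t}. ?c u *\<^sub>C g u)"
      using st assms(1) by (intro sum.mono_neutral_right) auto
    also have "\<dots> = 0"
      using st by simp
    finally show False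
      using zero[of ?c] st by auto
  qed
  show "cvec.independent (g ` I)"
  proof (rule cvec.independent_if_scalars_zero)
    fix f v assume 0: "(\<Sum>x\<in>g ` I. f x *\<^sub>C x) = 0" and "v \<in> g ` I"
    have "(\<Sum>s\<in>I. f (g s) *\<^sub>C g s) = 0"
      using 0 inj by (simp add: sum.reindex)
    from zero[OF this] show "f v = 0"
      using \<open>v \<in> g ` I\<close> by auto
  qed (use assms(1) in simp)
qed

context
  fixes T :: "'a::complex_hilbert \<Rightarrow> 'b::complex_hilbert \<Rightarrow> 'c::complex_hilbert"
  assumes T: "hilbert_tensor_product T"
begin

lemma norm_tensor: "norm (T x y) = norm x * norm y"
proof -
  have "cinner (T x y) (T x y) = cinner x x * cinner y y"
    using T by (simp add: hilbert_tensor_product_def)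
  then have "complex_of_real ((norm (T x y))\<^sup>2) = complex_of_real ((norm x * norm y)\<^sup>2)"
    by (simp add: cinner_self power_mult_distrib)
  then have "(norm (T x y))\<^sup>2 = (norm x * norm y)\<^sup>2"
    using of_real_eq_iff by blast
  then show ?thesis
    by simp
qed

lemma bounded_bilinear_tensor: "bounded_bilinear T"
proof
  fix x x' y y' and r :: real
  show "T (x + x') y = T x y + T x' y" "T x (y + y') = T x y + T x y'"
    using T by (simp_all add: hilbert_tensor_product_def)
  have "T (complex_of_real r *\<^sub>C x) y = complex_of_real r *\<^sub>C T x y"
    "T x (complex_of_real r *\<^sub>C y) = complex_of_real r *\<^sub>C T x y"
    using T by (simp_all only: hilbert_tensor_product_def)
  then show "T (r *\<^sub>R x) y = r *\<^sub>R T x y" "T x (r *\<^sub>R y) = r *\<^sub>R T x y"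
    by (simp_all add: scaleC_of_real)
  show "\<exists>K. \<forall>x y. norm (T x y) \<le> norm x * norm y * K"
    by (rule exI[of _ 1]) (simp add: norm_tensor)
qed

lemma scaleC_tensor: "T (c *\<^sub>C x) y = c *\<^sub>C T x y" "T x (c *\<^sub>C y) = c *\<^sub>C T x y"
  using T by (simp_all add: hilbert_tensor_product_def)

lemma tensor_frame_independent:
  assumes I: "finite I" "inj_on f I" "cvec.independent (f ` I)"
    and J: "finite J" "inj_on g J" "cvec.independent (g ` J)"
    and zero: "(\<Sum>(s, t)\<in>I \<times> J. c (s, t) *\<^sub>C T (f s) (g t)) = 0"
    and st: "s \<in> I" "t \<in> J"
  shows "c (s, t) = 0"
proof -
  have cinner_T: "cinner (T x y) (T u v) = cinner x u * cinner y v" for x y u v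
    using T by (simp add: hilbert_tensor_product_def)
  have inner_zero: "cinner (\<Sum>t\<in>J. c (s, t) *\<^sub>C g t) v = 0" if "s \<in> I" for s v
  proof -
    let ?a = "\<lambda>s. cinner (\<Sum>t\<in>J. c (s, t) *\<^sub>C g t) v"
    have "cinner (\<Sum>s\<in>I. ?a s *\<^sub>C f s) u = 0" for u
    proof -
      have "cinner (\<Sum>s\<in>I. ?a s *\<^sub>C f s) u
          = (\<Sum>s\<in>I. \<Sum>t\<in>J. c (s, t) * cinner (f s) u * cinner (g t) v)"
        by (simp add: cinner_sum_left cinner_scaleC_left sum_distrib_right sum_distrib_left mult_ac)
      also have "\<dots> = cinner (\<Sum>(s, t)\<in>I \<times> J. c (s, t) *\<^sub>C T (f s) (g t)) (T u v)"
        by (simp add: cinner_sum_left cinner_scaleC_left cinner_T sum.cartesian_product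
            case_prod_unfold mult_ac)
      finally show ?thesis
        by (simp add: zero cinner_zero_left)
    qed
    then have "(\<Sum>s\<in>I. ?a s *\<^sub>C f s) = 0"
      using cinner_eq_zeroD by blast
    from frame_zero_combination[OF I this that] show ?thesis .
  qed
  have "(\<Sum>t\<in>J. c (s, t) *\<^sub>C g t) = 0"
    using inner_zero[OF st(1)] cinner_eq_zeroD by blast
  from frame_zero_combination[OF J this st(2)] show ?thesis .
qed

lemma vholomorphic_tensor:
  assumes "vholomorphic_on f U" "vholomorphic_on g U"
  shows "vholomorphic_on (\<lambda>w. T (f w) (g w)) U"
  unfolding vholomorphic_on_def
proof
  fix z assume "z \<in> U"
  with assms obtain f' g' where
    "(f has_derivative (\<lambda>h. h *\<^sub>C f')) (at z within U)"
    "(g has_derivative (\<lambda>h. h *\<^sub>C g')) (at z within U)"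
    unfolding vholomorphic_on_def by blast
  from bounded_bilinear.FDERIV[OF bounded_bilinear_tensor this]
  show "\<exists>D. ((\<lambda>w. T (f w) (g w)) has_derivative (\<lambda>h. h *\<^sub>C D)) (at z within U)"
    by (intro exI[of _ "T (f z) g' + T f' (g z)"]) (simp add: scaleC_tensor scaleC_add_right)
qed

lemma tensor_in_span:
  assumes "x \<in> cvec.span A" "y \<in> cvec.span B"
  shows "T x y \<in> cvec.span {T a b | a b. a \<in> A \<and> b \<in> B}"
proof -
  interpret T: bounded_bilinear T by (rule bounded_bilinear_tensor)
  have 1: "T a y \<in> cvec.span {T a b | a b. a \<in> A \<and> b \<in> B}" if "a \<in> A" for a
    using assms(2)
  proof (induction rule: cvec.span_induct_alt)
    case base
    show ?case by (simp add: T.zero_right cvec.span_zero)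
  next
    case (step c b y)
    have "T a b \<in> cvec.span {T a b | a b. a \<in> A \<and> b \<in> B}"
      using that step by (intro cvec.span_base) blast
    with step show ?case
      by (simp add: T.add_right scaleC_tensor cvec.span_add cvec.span_scale)
  qed
  show ?thesis
    using assms(1)
  proof (induction rule: cvec.span_induct_alt)
    case base
    show ?case by (simp add: T.zero_left cvec.span_zero)
  next
    case (step c a x)
    with 1[of a] show ?case
      by (simp add: T.add_left scaleC_tensor cvec.span_add cvec.span_scale)
  qed
qed

lemma holomorphic_frame_tensor:
  assumes "finite I" "finite J" "holomorphic_frame I U E\<^sub>1 e\<^sub>1" "holomorphic_frame J U E\<^sub>2 e\<^sub>2"
  shows "holomorphic_frame (I \<times> J) U (tensor_bundle T E\<^sub>1 E\<^sub>2) (tensor_frame T e\<^sub>1 e\<^sub>2)"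
  unfolding holomorphic_frame_def
proof (intro conjI ballI)
  fix p assume "p \<in> I \<times> J"
  then show "vholomorphic_on (tensor_frame T e\<^sub>1 e\<^sub>2 p) U"
    using assms by (auto simp: tensor_frame_def holomorphic_frame_def intro!: vholomorphic_tensor)
next
  fix w assume w: "w \<in> U"
  let ?g = "\<lambda>p. tensor_frame T e\<^sub>1 e\<^sub>2 p w"
  let ?A = "(\<lambda>s. e\<^sub>1 s w) ` I" and ?B = "(\<lambda>t. e\<^sub>2 t w) ` J"
  have 1: "inj_on (\<lambda>s. e\<^sub>1 s w) I" "cvec.independent ?A" "cvec.span ?A = E\<^sub>1 w"
    and 2: "inj_on (\<lambda>t. e\<^sub>2 t w) J" "cvec.independent ?B" "cvec.span ?B = E\<^sub>2 w"
    using assms w by (auto simp: holomorphic_frame_def)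
  have zero: "\<forall>p\<in>I \<times> J. c p = 0" if "(\<Sum>p\<in>I \<times> J. c p *\<^sub>C ?g p) = 0" for c
    using tensor_frame_independent[OF assms(1) 1(1,2) assms(2) 2(1,2), of c] that
    by (auto simp: tensor_frame_def case_prod_unfold)
  have fin: "finite (I \<times> J)"
    using assms by simp
  show "inj_on ?g (I \<times> J)" "cvec.independent (?g ` (I \<times> J))"
    using frame_of_zero_combination[OF fin, of ?g] zero by blast+
  have img: "?g ` (I \<times> J) = {T a b | a b. a \<in> ?A \<and> b \<in> ?B}"
    unfolding tensor_frame_def by (force simp: image_iff)
  show "cvec.span (?g ` (I \<times> J)) = tensor_bundle T E\<^sub>1 E\<^sub>2 w"
  proof
    show "cvec.span (?g ` (I \<times> J)) \<subseteq> tensor_bundle T E\<^sub>1 E\<^sub>2 w"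
      unfolding img tensor_bundle_def 1(3)[symmetric] 2(3)[symmetric]
    proof (rule cvec.span_mono, rule subsetI)
      fix z assume "z \<in> {T a b | a b. a \<in> ?A \<and> b \<in> ?B}"
      then obtain a b where "z = T a b" "a \<in> ?A" "b \<in> ?B"
        by blast
      then show "z \<in> {T x y | x y. x \<in> cvec.span ?A \<and> y \<in> cvec.span ?B}"
        using cvec.span_base[of a ?A] cvec.span_base[of b ?B] by blast
    qed
    show "tensor_bundle T E\<^sub>1 E\<^sub>2 w \<subseteq> cvec.span (?g ` (I \<times> J))"
      unfolding img tensor_bundle_def 1(3)[symmetric] 2(3)[symmetric]
    proof (rule cvec.span_minimal[OF _ cvec.subspace_span], rule subsetI)
      fix z assume "z \<in> {T x y | x y. x \<in> cvec.span ?A \<and> y \<in> cvec.span ?B}"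
      then obtain x y where "z = T x y" "x \<in> cvec.span ?A" "y \<in> cvec.span ?B"
        by blast
      then show "z \<in> cvec.span {T a b | a b. a \<in> ?A \<and> b \<in> ?B}"
        using tensor_in_span[of x ?A y ?B] by simp
    qed
  qed
qed

lemma hermitian_holomorphic_bundle_tensor:
  assumes "hermitian_holomorphic_bundle \<Omega> n E\<^sub>1" "hermitian_holomorphic_bundle \<Omega> m E\<^sub>2"
  shows "hermitian_holomorphic_bundle \<Omega> (n * m) (tensor_bundle T E\<^sub>1 E\<^sub>2)"
  unfolding hermitian_holomorphic_bundle_def
proof
  have restrict: "holomorphic_frame I V E \<gamma>"
    if "holomorphic_frame I U E \<gamma>" "V \<subseteq> U"
    for I :: "nat set" and U V and E :: "complex \<Rightarrow> 'd::complex_hilbert set" and \<gamma>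
    using that unfolding holomorphic_frame_def vholomorphic_on_def
    by (meson has_derivative_subset subsetD)
  fix w assume "w \<in> \<Omega>"
  then obtain U e\<^sub>1 where U: "open U" "w \<in> U" "U \<subseteq> \<Omega>"
    and e1: "holomorphic_frame {..<n} U E\<^sub>1 e\<^sub>1"
    using assms(1) unfolding hermitian_holomorphic_bundle_def by metis
  from \<open>w \<in> \<Omega>\<close> obtain V e\<^sub>2 where V: "open V" "w \<in> V" "V \<subseteq> \<Omega>"
    and e2: "holomorphic_frame {..<m} V E\<^sub>2 e\<^sub>2"
    using assms(2) unfolding hermitian_holomorphic_bundle_def by metis
  have frame: "holomorphic_frame ({..<n} \<times> {..<m}) (U \<inter> V) (tensor_bundle T E\<^sub>1 E\<^sub>2)
      (tensor_frame T e\<^sub>1 e\<^sub>2)"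
    using restrict[OF e1, of "U \<inter> V"] restrict[OF e2, of "U \<inter> V"]
    by (intro holomorphic_frame_tensor) auto
  obtain b where b: "bij_betw b {..<n * m} ({..<n} \<times> {..<m})"
    using finite_same_card_bij[of "{..<n * m}" "{..<n} \<times> {..<m}"]
    by (auto simp: card_cartesian_product)
  have b': "b ` {..<n * m} = {..<n} \<times> {..<m}" "inj_on b {..<n * m}"
    using b by (auto simp: bij_betw_def)
  have "holomorphic_frame {..<n * m} (U \<inter> V) (tensor_bundle T E\<^sub>1 E\<^sub>2)
      (\<lambda>k. tensor_frame T e\<^sub>1 e\<^sub>2 (b k))"
    unfolding holomorphic_frame_def
  proof (intro conjI ballI)
    fix k assume "k \<in> {..<n * m}"
    then have "b k \<in> {..<n} \<times> {..<m}"
      using b'(1) by blast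
    then show "vholomorphic_on (tensor_frame T e\<^sub>1 e\<^sub>2 (b k)) (U \<inter> V)"
      by (rule frame[unfolded holomorphic_frame_def, THEN conjunct1, rule_format])
  next
    fix w assume w: "w \<in> U \<inter> V"
    let ?g = "\<lambda>p. tensor_frame T e\<^sub>1 e\<^sub>2 p w"
    have g: "inj_on ?g ({..<n} \<times> {..<m})"
      "cvec.independent (?g ` ({..<n} \<times> {..<m}))"
      "cvec.span (?g ` ({..<n} \<times> {..<m})) = tensor_bundle T E\<^sub>1 E\<^sub>2 w"
      using frame[unfolded holomorphic_frame_def, THEN conjunct2, rule_format, OF w] by simp_all
    have img: "(\<lambda>k. ?g (b k)) ` {..<n * m} = ?g ` ({..<n} \<times> {..<m})"
      unfolding b'(1)[symmetric] by (rule image_image[symmetric])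
    show "inj_on (\<lambda>k. ?g (b k)) {..<n * m}"
      using comp_inj_on[OF b'(2), of ?g] g(1) b'(1) by (simp add: comp_def)
    show "cvec.independent ((\<lambda>k. ?g (b k)) ` {..<n * m})"
      "cvec.span ((\<lambda>k. ?g (b k)) ` {..<n * m}) = tensor_bundle T E\<^sub>1 E\<^sub>2 w"
      unfolding img by (fact g)+
  qed
  then show "\<exists>W \<gamma>. open W \<and> w \<in> W \<and> W \<subseteq> \<Omega> \<and>
      holomorphic_frame {..<n * m} W (tensor_bundle T E\<^sub>1 E\<^sub>2) \<gamma>"
    using U V by (intro exI[of _ "U \<inter> V"] exI conjI) auto
qed

end

end

theory Submission
  imports Defs "HOL-Complex_Analysis.Cauchy_Integral_Formula"
begin

text \<open>
  The Gram matrix of the frame of simple tensors is \<open>h\<^sub>1 \<otimes> h\<^sub>2\<close>, so the product rule gives the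
  connection matrix \<open>\<Theta>\<^sub>1 \<otimes> I + I \<otimes> \<Theta>\<^sub>2\<close>.  Matrices of the form \<open>A \<otimes> I + I \<otimes> B\<close> are preserved by
  \<open>\<partial>\<close>, by its conjugate, and by commutators, since \<open>A \<otimes> I\<close> and \<open>I \<otimes> B\<close> commute; hence every
  covariant derivative acts on the two summands separately.  The analytic point is that all
  matrices involved are smooth, which reduces to the fact that the derivative of a Hilbert-space
  valued holomorphic function is holomorphic.
\<close>

section \<open>The inner product\<close>

lemma cinner_add_right: "cinner x (y + z) = cinner x y + cinner x z"
  for x :: "'a::complex_hilbert"
  by (metis cinner_add_left cinner_commute complex_cnj_add)

lemma cinner_scaleC_right: "cinner x (c *\<^sub>C y) = cnj c * cinner x y"
  for x :: "'a::complex_hilbert"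
  by (metis cinner_commute cinner_scaleC_left complex_cnj_mult)

text \<open>The class relates norm and scalars only for real scalars; the complex case follows
  because the inner product induces the norm.\<close>

lemma norm_scaleC: "norm (c *\<^sub>C x) = cmod c * norm x"
  for x :: "'a::complex_hilbert"
proof -
  have "cinner (c *\<^sub>C x) (c *\<^sub>C x) = of_real ((cmod c)\<^sup>2) * cinner x x"
    by (simp only: cinner_scaleC_left cinner_scaleC_right complex_norm_square mult_ac)
  then have "complex_of_real ((norm (c *\<^sub>C x))\<^sup>2) = complex_of_real ((cmod c * norm x)\<^sup>2)"
    by (simp add: cinner_self power_mult_distrib)
  then have "(norm (c *\<^sub>C x))\<^sup>2 = (cmod c * norm x)\<^sup>2"
    using of_real_eq_iff by blast
  then show ?thesis
    by simp
qed

text \<open>Cauchy-Schwarz. Here the triangle inequality is already available from the norm, so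
  squaring it bounds the real part of the inner product; a rotation of \<open>x\<close> then turns
  the real part into the modulus.\<close>

lemma cmod_cinner_le: "cmod (cinner x y) \<le> norm x * norm y"
  for x y :: "'a::complex_hilbert"
proof -
  have Re_le: "Re (cinner u y) \<le> norm u * norm y" for u
  proof -
    have "complex_of_real ((norm (u + y))\<^sup>2)
        = of_real ((norm u)\<^sup>2) + cinner u y + cnj (cinner u y) + of_real ((norm y)\<^sup>2)"
      by (metis (no_types, lifting) add.assoc cinner_add_left cinner_add_right cinner_commute
          cinner_self)
    then have "(norm (u + y))\<^sup>2 = (norm u)\<^sup>2 + 2 * Re (cinner u y) + (norm y)\<^sup>2"
      by (auto simp: complex_eq_iff)
    moreover have "(norm (u + y))\<^sup>2 \<le> (norm u + norm y)\<^sup>2"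
      by (intro power_mono norm_triangle_ineq) simp
    ultimately show ?thesis
      by (simp add: power2_sum)
  qed
  show ?thesis
  proof (cases "cinner x y = 0")
    case False
    \<comment> \<open>Multiplying by this unimodular number rotates \<open>cinner x y\<close> onto
      the positive real axis.\<close>
    define c where "c = cnj (sgn (cinner x y))"
    have "c * cinner x y = of_real (cmod (cinner x y))"
      using False by (simp add: c_def sgn_div_norm scaleR_conv_of_real field_simps
          power2_eq_square flip: complex_norm_square)
    moreover have "cmod c = 1"
      using False by (simp add: c_def norm_sgn)
    ultimately show ?thesis
      using Re_le[of "c *\<^sub>C x"] by (simp add: cinner_scaleC_left norm_scaleC)
  qed simp
qed

text \<open>Over the reals a sesquilinear form is bilinear, so the library's product rule for
  derivatives and its continuity facts apply to \<open>cinner\<close>.\<close>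

lemma bounded_bilinear_cinner:
  "bounded_bilinear (cinner :: 'a::complex_hilbert \<Rightarrow> 'a \<Rightarrow> complex)"
proof
  fix x x' y y' :: 'a and r :: real
  show "cinner (x + x') y = cinner x y + cinner x' y"
    "cinner x (y + y') = cinner x y + cinner x y'"
    by (simp_all add: cinner_add_left cinner_add_right)
  show "cinner (r *\<^sub>R x) y = r *\<^sub>R cinner x y" "cinner x (r *\<^sub>R y) = r *\<^sub>R cinner x y"
    using cinner_scaleC_left[of "of_real r" x y] cinner_scaleC_right[of x "of_real r" y]
    by (simp_all add: scaleC_of_real scaleR_conv_of_real)
  show "\<exists>K. \<forall>x y :: 'a. norm (cinner x y) \<le> norm x * norm y * K"
    by (rule exI[of _ 1]) (simp add: cmod_cinner_le)
qed

interpretation cinner: bounded_bilinear "cinner :: 'a::complex_hilbert \<Rightarrow> 'a \<Rightarrow> complex"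
  by (rule bounded_bilinear_cinner)

text \<open>Testing with \<open>v = x\<close> suffices. This turns scalar estimates that are uniform
  in \<open>v\<close> back into norm estimates.\<close>

lemma norm_le_of_cinner_le:
  fixes x :: "'a::complex_hilbert"
  assumes "0 \<le> B" and "\<And>v. cmod (cinner x v) \<le> B * norm v"
  shows "norm x \<le> B"
proof (cases "x = 0")
  case False
  have "norm x * norm x \<le> B * norm x"
    using assms(2)[of x] by (simp add: cinner_self power2_eq_square norm_mult)
  with False show ?thesis
    by simp
qed (use assms(1) in simp)

section \<open>Vector-valued holomorphic functions\<close>

text \<open>The scalar functions \<open>\<langle>f, v\<rangle>\<close> satisfy Cauchy estimates that are uniform in \<open>\<parallel>v\<parallel> \<le> 1\<close>, so the
  difference quotients of the derivative are Cauchy in norm.\<close>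
lemma vholomorphic_derivative:
  fixes f g :: "complex \<Rightarrow> 'a::complex_hilbert"
  assumes U: "open U"
    and fg: "\<And>z. z \<in> U \<Longrightarrow> (f has_derivative (\<lambda>h. h *\<^sub>C g z)) (at z)"
  shows "vholomorphic_on g U"
  unfolding vholomorphic_on_def
proof
  fix z\<^sub>0 assume "z\<^sub>0 \<in> U"
  then obtain R where R: "R > 0" "cball z\<^sub>0 R \<subseteq> U"
    using U open_contains_cball by blast
  \<comment> \<open>Halving the radius keeps the disc of radius \<open>r\<close> about any point of
    \<open>cball z\<^sub>0 r\<close> inside \<open>cball z\<^sub>0 R\<close>, where \<open>f\<close>
    is bounded by \<open>M\<close>.\<close>
  define r where "r = R / 2"
  have r: "r > 0" "R = 2 * r"
    using R by (auto simp: r_def)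
  have "continuous_on (cball z\<^sub>0 R) f"
    using R(2) fg by (intro continuous_at_imp_continuous_on ballI) (meson has_derivative_continuous subsetD)
  then have "bounded (f ` cball z\<^sub>0 R)"
    by (intro compact_imp_bounded compact_continuous_image) auto
  then obtain M where M: "M > 0" "\<And>z. z \<in> cball z\<^sub>0 R \<Longrightarrow> norm (f z) \<le> M"
    by (auto simp: bounded_pos)
  \<comment> \<open>The Cauchy bound for a third derivative on discs of radius \<open>r\<close>,
    with the factor \<open>norm v\<close> left out.\<close>
  define C where "C = fact 3 * M / r ^ 3"
  have C: "C > 0"
    using M r by (simp add: C_def)
  define u where "u v z = cinner (f z) v" for v z
  have u_deriv: "(u v has_field_derivative cinner (g z) v) (at z)" if "z \<in> U" for v z
  proof -
    have "((\<lambda>z. cinner (f z) v) has_derivative (\<lambda>h. cinner (h *\<^sub>C g z) v)) (at z)"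
      using fg[OF that] by (rule cinner.bounded_linear_left[THEN bounded_linear.has_derivative])
    then show ?thesis
      by (simp add: has_field_derivative_def u_def[abs_def] cinner_scaleC_left mult_commute_abs)
  qed
  have hol: "u v holomorphic_on U" for v
    using u_deriv U by (meson holomorphic_on_open)
  have third: "cmod ((deriv ^^ 3) (u v) w) \<le> C * norm v" if "w \<in> cball z\<^sub>0 r" for v w
  proof -
    have sub: "cball w r \<subseteq> cball z\<^sub>0 R"
      using that r by (auto simp: dist_commute) (smt (verit) dist_triangle)
    have "cmod ((deriv ^^ 3) (u v) w) \<le> fact 3 * (M * norm v) / r ^ 3"
    proof (rule Cauchy_inequality)
      show "u v holomorphic_on ball w r"
        using hol sub R(2) ball_subset_cball by (meson holomorphic_on_subset order_trans)
      show "continuous_on (cball w r) (u v)"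
        using hol sub R(2) by (meson holomorphic_on_imp_continuous_on holomorphic_on_subset order_trans)
      fix x assume "cmod (w - x) = r"
      then have "x \<in> cball z\<^sub>0 R"
        using sub by (auto simp: dist_norm)
      then show "cmod (u v x) \<le> M * norm v"
        unfolding u_def using M(2)[of x] cmod_cinner_le[of "f x" v]
        by (meson mult_right_mono norm_ge_zero order_trans)
    qed (use r in auto)
    then show ?thesis
      by (simp add: C_def)
  qed
  have du: "deriv (u v) z = cinner (g z) v" if "z \<in> U" for v z
    using u_deriv[OF that] by (rule DERIV_imp_deriv)
  have taylor: "cmod (cinner (g (z\<^sub>0 + h) - g z\<^sub>0) v - (deriv ^^ 2) (u v) z\<^sub>0 * h) \<le> C * norm v * (cmod h)\<^sup>2"
    if "cmod h \<le> r" for h v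
  proof -
    \<comment> \<open>The family is shifted by one: \<open>?F 0\<close> is the pairing of
      \<open>g\<close> with \<open>v\<close>, and the remainder of the first-order expansion
      involves the third derivative of \<open>u v\<close>.\<close>
    let ?S = "cball z\<^sub>0 r" and ?F = "\<lambda>i. (deriv ^^ Suc i) (u v)"
    have S: "?S \<subseteq> U"
      using R r by auto
    have in_S: "z\<^sub>0 \<in> ?S" "z\<^sub>0 + h \<in> ?S"
      using that r by (auto simp: dist_norm)
    have "cmod (?F 0 (z\<^sub>0 + h) - (\<Sum>i\<le>1. ?F i z\<^sub>0 * (z\<^sub>0 + h - z\<^sub>0) ^ i / fact i))
        \<le> C * norm v * cmod (z\<^sub>0 + h - z\<^sub>0) ^ Suc 1 / fact 1"
    proof (rule complex_Taylor[of ?S 1 ?F])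
      fix i x assume "x \<in> ?S" "i \<le> (1::nat)"
      then show "(?F i has_field_derivative ?F (Suc i) x) (at x within ?S)"
        using has_field_derivative_higher_deriv[OF hol U, of x "Suc i" v] S
        by (blast intro: has_field_derivative_at_within)
    next
      fix x assume "x \<in> ?S"
      then show "cmod (?F (Suc 1) x) \<le> C * norm v"
        using third[of x v] by (simp add: numeral_3_eq_3)
    qed (use in_S in auto)
    then show ?thesis
      using in_S S du[of z\<^sub>0 v] du[of "z\<^sub>0 + h" v]
      by (auto simp: cinner.diff_left numeral_2_eq_2 algebra_simps subset_iff)
  qed
  \<comment> \<open>The difference quotient of \<open>g\<close> at \<open>z\<^sub>0\<close>, whose
    limit in norm is sought.\<close>
  define q where "q h = inverse h *\<^sub>C (g (z\<^sub>0 + h) - g z\<^sub>0)" for h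
  have q: "cmod (cinner (q h) v - (deriv ^^ 2) (u v) z\<^sub>0) \<le> C * norm v * cmod h"
    if "cmod h \<le> r" "h \<noteq> 0" for h v
  proof -
    have "cmod h * cmod (cinner (q h) v - (deriv ^^ 2) (u v) z\<^sub>0)
        = cmod (cinner (g (z\<^sub>0 + h) - g z\<^sub>0) v - (deriv ^^ 2) (u v) z\<^sub>0 * h)"
      using that(2) by (simp add: q_def cinner_scaleC_left right_diff_distrib mult.commute[of h]
          flip: norm_mult mult.assoc)
    also have "\<dots> \<le> C * norm v * (cmod h)\<^sup>2"
      by (rule taylor[OF that(1)])
    also have "\<dots> = cmod h * (C * norm v * cmod h)"
      by (simp add: power2_eq_square)
    finally show ?thesis
      using that(2) by simp
  qed
  \<comment> \<open>The limit of \<open>cinner (q h) v\<close> is so far known only as a scalar for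
    each \<open>v\<close>. It cancels when two quotients are compared, leaving a bound uniform in
    \<open>v\<close>.\<close>
  have q_diff: "norm (q h - q k) \<le> C * (cmod h + cmod k)"
    if "cmod h \<le> r" "h \<noteq> 0" "cmod k \<le> r" "k \<noteq> 0" for h k
  proof (rule norm_le_of_cinner_le)
    show "0 \<le> C * (cmod h + cmod k)"
      using C by simp
    fix v
    let ?d = "(deriv ^^ 2) (u v) z\<^sub>0"
    have "cmod (cinner (q h - q k) v) = cmod ((cinner (q h) v - ?d) - (cinner (q k) v - ?d))"
      by (simp add: cinner.diff_left)
    also have "\<dots> \<le> cmod (cinner (q h) v - ?d) + cmod (cinner (q k) v - ?d)"
      by (rule norm_triangle_ineq4)
    also have "\<dots> \<le> C * (cmod h + cmod k) * norm v"
      using q[OF that(1,2), of v] q[OF that(3,4), of v] by (simp add: algebra_simps)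
    finally show "cmod (cinner (q h - q k) v) \<le> C * (cmod h + cmod k) * norm v" .
  qed
  \<comment> \<open>Concrete nonzero increments of modulus at most \<open>r\<close> that tend to 0;
    completeness along this one sequence produces the candidate derivative \<open>L\<close>.\<close>
  define k where "k n = complex_of_real (r * inverse (of_nat (Suc n)))" for n
  have k: "cmod (k n) \<le> r" "k n \<noteq> 0" for n
  proof -
    have "r * inverse (real (Suc n)) \<le> r * 1"
      using r by (intro mult_left_mono) (auto simp: inverse_le_1_iff)
    then show "cmod (k n) \<le> r" "k n \<noteq> 0"
      using r by (simp_all add: k_def norm_mult norm_inverse del: of_nat_Suc)
  qed
  have k_lim: "k \<longlonglongrightarrow> 0"
    unfolding k_def using tendsto_of_real[OF tendsto_mult_left[OF LIMSEQ_inverse_real_of_nat, of r], where 'a=complex]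
    by simp
  have "Cauchy (\<lambda>n. q (k n))"
  proof (rule metric_CauchyI)
    fix e :: real assume "e > 0"
    then have "e / (2 * C) > 0"
      using C by simp
    with k_lim obtain N where N: "\<And>n. n \<ge> N \<Longrightarrow> cmod (k n) < e / (2 * C)"
      by (metis LIMSEQ_D diff_zero)
    have "dist (q (k m)) (q (k n)) < e" if "m \<ge> N" "n \<ge> N" for m n
      using q_diff[OF k[of m] k[of n]] N[OF that(1)] N[OF that(2)] C
      by (simp add: dist_norm field_simps)
    then show "\<exists>N. \<forall>m\<ge>N. \<forall>n\<ge>N. dist (q (k m)) (q (k n)) < e"
      by blast
  qed
  then obtain L where L: "(\<lambda>n. q (k n)) \<longlonglongrightarrow> L"
    using Cauchy_convergent convergent_def by blast
  \<comment> \<open>Letting the second increment in \<open>q_diff\<close> run through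
    \<open>k\<close> extends the convergence to arbitrary small \<open>h\<close>.\<close>
  have qL: "norm (q h - L) \<le> C * cmod h" if "cmod h \<le> r" "h \<noteq> 0" for h
  proof (rule LIMSEQ_le)
    show "(\<lambda>n. norm (q h - q (k n))) \<longlonglongrightarrow> norm (q h - L)"
      by (intro tendsto_intros L)
    show "(\<lambda>n. C * (cmod h + cmod (k n))) \<longlonglongrightarrow> C * cmod h"
      using k_lim by (auto intro!: tendsto_eq_intros)
    show "\<exists>N. \<forall>n\<ge>N. norm (q h - q (k n)) \<le> C * (cmod h + cmod (k n))"
      using q_diff[OF that k] by blast
  qed
  have gL: "norm (g (z\<^sub>0 + h) - g z\<^sub>0 - h *\<^sub>C L) \<le> C * (cmod h)\<^sup>2" if "cmod h \<le> r" for h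
  proof (cases "h = 0")
    case False
    have "g (z\<^sub>0 + h) - g z\<^sub>0 - h *\<^sub>C L = h *\<^sub>C (q h - L)"
      using False by (simp add: q_def cvec.scale_right_diff_distrib scaleC_scaleC scaleC_one)
    then show ?thesis
      using mult_left_mono[OF qL[OF that False], of "cmod h"]
      by (simp add: norm_scaleC power2_eq_square mult.left_commute)
  qed simp
  have "(g has_derivative (\<lambda>h. h *\<^sub>C L)) (at z\<^sub>0)"
    unfolding has_derivative_at
  proof
    show "bounded_linear (\<lambda>h. h *\<^sub>C L)"
    proof
      fix r and b :: complex
      show "(r *\<^sub>R b) *\<^sub>C L = r *\<^sub>R b *\<^sub>C L"
        by (metis scaleC_of_real scaleC_scaleC scaleR_conv_of_real)
      show "\<exists>K. \<forall>x. norm (x *\<^sub>C L) \<le> cmod x * K"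
        by (auto simp: norm_scaleC)
    qed (simp add: scaleC_add_left)
    show "(\<lambda>h. norm (g (z\<^sub>0 + h) - g z\<^sub>0 - h *\<^sub>C L) / norm h) \<midarrow>0\<rightarrow> 0"
    proof (rule tendsto_sandwich)
      show "\<forall>\<^sub>F h in at 0. 0 \<le> norm (g (z\<^sub>0 + h) - g z\<^sub>0 - h *\<^sub>C L) / norm h"
        by simp
      have "\<forall>\<^sub>F h in at 0. h \<noteq> 0 \<and> cmod h < r"
        using r by (auto simp: eventually_at intro!: exI[of _ r])
      then show "\<forall>\<^sub>F h in at 0. norm (g (z\<^sub>0 + h) - g z\<^sub>0 - h *\<^sub>C L) / norm h \<le> C * cmod h"
        by eventually_elim (use gL in \<open>simp add: field_simps power2_eq_square\<close>)
      show "((\<lambda>h. C * cmod h) \<longlongrightarrow> 0) (at 0)"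
        by (auto intro!: tendsto_eq_intros)
    qed auto
  qed
  then show "\<exists>f'. (g has_derivative (\<lambda>h. h *\<^sub>C f')) (at z\<^sub>0 within U)"
    using has_derivative_at_withinI by blast
qed

section \<open>Smooth functions\<close>

text \<open>The witnesses \<open>a\<close> and \<open>b\<close> are the Wirtinger derivatives of \<open>f\<close>.\<close>
primrec times_differentiable :: "nat \<Rightarrow> complex set \<Rightarrow> (complex \<Rightarrow> complex) \<Rightarrow> bool" where
  "times_differentiable 0 U f \<longleftrightarrow> True"
| "times_differentiable (Suc k) U f \<longleftrightarrow>
     (\<exists>a b. (\<forall>w\<in>U. (f has_derivative (\<lambda>h. a w * h + b w * cnj h)) (at w)) \<and>
            times_differentiable k U a \<and> times_differentiable k U b)"

text \<open>Each real-linear self-map of the complex plane has a unique form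
  \<open>a * h + b * cnj h\<close>, so on open sets this is ordinary real infinite
  differentiability.\<close>

definition smooth_on :: "complex set \<Rightarrow> (complex \<Rightarrow> complex) \<Rightarrow> bool" where
  "smooth_on U f \<longleftrightarrow> (\<forall>k. times_differentiable k U f)"

lemma times_differentiable_SucI:
  assumes "\<And>w. w \<in> U \<Longrightarrow> (f has_derivative (\<lambda>h. a w * h + b w * cnj h)) (at w)"
    and "times_differentiable k U a" "times_differentiable k U b"
  shows "times_differentiable (Suc k) U f"
  using assms by auto

lemma times_differentiable_SucE:
  assumes "times_differentiable (Suc k) U f"
  obtains a b where
    "\<And>w. w \<in> U \<Longrightarrow> (f has_derivative (\<lambda>h. a w * h + b w * cnj h)) (at w)"
    "times_differentiable k U a" "times_differentiable k U b"
  using assms by auto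

text \<open>Product and reciprocal rules contain the undifferentiated functions, which are therefore
  required at the lower order too.\<close>

lemma times_differentiable_mono:
  "times_differentiable (Suc k) U f \<Longrightarrow> times_differentiable k U f"
proof (induction k arbitrary: f)
  case (Suc k)
  from Suc.prems show ?case
  proof (rule times_differentiable_SucE)
    fix a b
    assume "\<And>w. w \<in> U \<Longrightarrow> (f has_derivative (\<lambda>h. a w * h + b w * cnj h)) (at w)"
      "times_differentiable (Suc k) U a" "times_differentiable (Suc k) U b"
    then show ?thesis
      using times_differentiable_SucI Suc.IH by blast
  qed
qed simp

text \<open>The witnesses for \<open>f\<close> also serve for \<open>g\<close>, so a case
  distinction replaces induction; openness makes the derivatives agree.\<close>

lemma times_differentiable_cong:
  assumes "open U" "\<And>w. w \<in> U \<Longrightarrow> f w = g w" "times_differentiable k U f"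
  shows "times_differentiable k U g"
proof (cases k)
  case (Suc n)
  with assms(3) obtain a b where ab:
    "\<forall>w\<in>U. (f has_derivative (\<lambda>h. a w * h + b w * cnj h)) (at w)"
    "times_differentiable n U a" "times_differentiable n U b"
    by auto
  have "\<forall>w\<in>U. (g has_derivative (\<lambda>h. a w * h + b w * cnj h)) (at w)"
    using ab(1) assms(1,2) by (blast intro: has_derivative_transform_within_open)
  with ab Suc show ?thesis
    by auto
qed simp

lemma times_differentiable_const: "times_differentiable k U (\<lambda>w. c)"
proof (induction k arbitrary: c)
  case (Suc k)
  then show ?case
    by (intro times_differentiable_SucI[where a = "\<lambda>w. 0" and b = "\<lambda>w. 0"]) auto
qed simp

lemma times_differentiable_add:
  "times_differentiable k U f \<Longrightarrow> times_differentiable k U g \<Longrightarrow>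
   times_differentiable k U (\<lambda>w. f w + g w)"
proof (induction k arbitrary: f g)
  case (Suc k)
  from Suc.prems obtain a b c d where f:
    "\<forall>w\<in>U. (f has_derivative (\<lambda>h. a w * h + b w * cnj h)) (at w)"
    "times_differentiable k U a" "times_differentiable k U b"
    and g: "\<forall>w\<in>U. (g has_derivative (\<lambda>h. c w * h + d w * cnj h)) (at w)"
    "times_differentiable k U c" "times_differentiable k U d"
    by auto
  have "((\<lambda>w. f w + g w) has_derivative (\<lambda>h. (a w + c w) * h + (b w + d w) * cnj h)) (at w)"
    if "w \<in> U" for w
    using has_derivative_add[OF f(1)[rule_format, OF that] g(1)[rule_format, OF that]]
    by (simp add: algebra_simps)
  moreover have "times_differentiable k U (\<lambda>w. a w + c w)" "times_differentiable k U (\<lambda>w. b w + d w)"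
    using f g by (auto intro: Suc.IH)
  ultimately show ?case
    by (rule times_differentiable_SucI)
qed simp

lemma times_differentiable_mult:
  "times_differentiable k U f \<Longrightarrow> times_differentiable k U g \<Longrightarrow>
   times_differentiable k U (\<lambda>w. f w * g w)"
proof (induction k arbitrary: f g)
  case (Suc k)
  from Suc.prems obtain a b c d where f:
    "\<forall>w\<in>U. (f has_derivative (\<lambda>h. a w * h + b w * cnj h)) (at w)"
    "times_differentiable k U a" "times_differentiable k U b"
    and g: "\<forall>w\<in>U. (g has_derivative (\<lambda>h. c w * h + d w * cnj h)) (at w)"
    "times_differentiable k U c" "times_differentiable k U d"
    by auto
  have fg: "times_differentiable k U f" "times_differentiable k U g"
    using Suc.prems by (auto intro: times_differentiable_mono simp del: times_differentiable.simps)
  have "((\<lambda>w. f w * g w) has_derivative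
      (\<lambda>h. (f w * c w + a w * g w) * h + (f w * d w + b w * g w) * cnj h)) (at w)"
    if "w \<in> U" for w
    using has_derivative_mult[OF f(1)[rule_format, OF that] g(1)[rule_format, OF that]]
    by (simp add: algebra_simps)
  moreover have "times_differentiable k U (\<lambda>w. f w * c w + a w * g w)"
    "times_differentiable k U (\<lambda>w. f w * d w + b w * g w)"
    using f g fg by (auto intro!: Suc.IH times_differentiable_add)
  ultimately show ?case
    by (rule times_differentiable_SucI)
qed simp

lemma times_differentiable_inverse:
  "times_differentiable k U f \<Longrightarrow> (\<And>w. w \<in> U \<Longrightarrow> f w \<noteq> 0) \<Longrightarrow>
   times_differentiable k U (\<lambda>w. inverse (f w))"
proof (induction k)
  case (Suc k)
  from Suc.prems obtain a b where f:
    "\<forall>w\<in>U. (f has_derivative (\<lambda>h. a w * h + b w * cnj h)) (at w)"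
    "times_differentiable k U a" "times_differentiable k U b"
    by auto
  have inv: "times_differentiable k U (\<lambda>w. inverse (f w))"
    using Suc times_differentiable_mono by blast
  \<comment> \<open>The derivative of a reciprocal, with negation written as a factor
    \<open>- 1\<close> so that the rules for products and constants cover it.\<close>
  let ?i = "\<lambda>a w. - 1 * (inverse (f w) * (a w * inverse (f w)))"
  have "((\<lambda>w. inverse (f w)) has_derivative (\<lambda>h. ?i a w * h + ?i b w * cnj h)) (at w)"
    if "w \<in> U" for w
    using Deriv.has_derivative_inverse[OF Suc.prems(2)[OF that] f(1)[rule_format, OF that]]
    by (simp add: algebra_simps)
  moreover have "times_differentiable k U (?i a)" "times_differentiable k U (?i b)"
    by (intro times_differentiable_mult times_differentiable_const f inv)+
  ultimately show ?case
    by (rule times_differentiable_SucI)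
qed simp

text \<open>Since \<open>cinner\<close> is conjugate linear in its second argument, the Wirtinger
  derivatives of the pairing of \<open>f\<close> and \<open>g\<close> pair \<open>f'\<close> with
  \<open>g\<close> and \<open>f\<close> with \<open>g'\<close>. Both are again pairings of
  holomorphic functions, so the induction closes.\<close>

lemma times_differentiable_cinner:
  fixes f g :: "complex \<Rightarrow> 'a::complex_hilbert"
  assumes U: "open U"
  shows "vholomorphic_on f U \<Longrightarrow> vholomorphic_on g U \<Longrightarrow>
    times_differentiable k U (\<lambda>w. cinner (f w) (g w))"
proof (induction k arbitrary: f g)
  case (Suc k)
  have deriv: "\<exists>f'. (\<forall>z\<in>U. (f has_derivative (\<lambda>h. h *\<^sub>C f' z)) (at z)) \<and> vholomorphic_on f' U"
    if "vholomorphic_on f U" for f :: "complex \<Rightarrow> 'a"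
  proof -
    have "\<forall>z\<in>U. \<exists>f'. (f has_derivative (\<lambda>h. h *\<^sub>C f')) (at z)"
      using that U by (simp add: vholomorphic_on_def at_within_open[of _ U])
    from bchoice[OF this] obtain f' where "\<forall>z\<in>U. (f has_derivative (\<lambda>h. h *\<^sub>C f' z)) (at z)"
      by blast
    with vholomorphic_derivative[OF U, of f f'] show ?thesis
      by auto
  qed
  obtain f' where f': "\<forall>z\<in>U. (f has_derivative (\<lambda>h. h *\<^sub>C f' z)) (at z)" "vholomorphic_on f' U"
    using deriv[OF Suc.prems(1)] by blast
  obtain g' where g': "\<forall>z\<in>U. (g has_derivative (\<lambda>h. h *\<^sub>C g' z)) (at z)" "vholomorphic_on g' U"
    using deriv[OF Suc.prems(2)] by blast
  have "((\<lambda>w. cinner (f w) (g w)) has_derivative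
      (\<lambda>h. cinner (f' w) (g w) * h + cinner (f w) (g' w) * cnj h)) (at w)" if "w \<in> U" for w
    using cinner.FDERIV[OF f'(1)[rule_format, OF that] g'(1)[rule_format, OF that]]
    by (simp add: cinner_scaleC_left cinner_scaleC_right algebra_simps)
  moreover have "times_differentiable k U (\<lambda>w. cinner (f' w) (g w))"
    "times_differentiable k U (\<lambda>w. cinner (f w) (g' w))"
    using Suc f' g' by auto
  ultimately show ?case
    by (rule times_differentiable_SucI)
qed simp

lemma smooth_on_cong:
  "open U \<Longrightarrow> (\<And>w. w \<in> U \<Longrightarrow> f w = g w) \<Longrightarrow> smooth_on U f \<Longrightarrow> smooth_on U g"
  unfolding smooth_on_def using times_differentiable_cong by blast

lemma smooth_on_const [intro]: "smooth_on U (\<lambda>w. c)"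
  and smooth_on_add [intro]:
    "smooth_on U f \<Longrightarrow> smooth_on U g \<Longrightarrow> smooth_on U (\<lambda>w. f w + g w)"
  and smooth_on_mult [intro]:
    "smooth_on U f \<Longrightarrow> smooth_on U g \<Longrightarrow> smooth_on U (\<lambda>w. f w * g w)"
  and smooth_on_inverse:
    "smooth_on U f \<Longrightarrow> (\<And>w. w \<in> U \<Longrightarrow> f w \<noteq> 0) \<Longrightarrow> smooth_on U (\<lambda>w. inverse (f w))"
  by (simp_all add: smooth_on_def times_differentiable_const times_differentiable_add
      times_differentiable_mult times_differentiable_inverse)

lemma smooth_on_uminus [intro]: "smooth_on U f \<Longrightarrow> smooth_on U (\<lambda>w. - f w)"
  using smooth_on_mult[OF smooth_on_const[of U "- 1"], of f] by simp

lemma smooth_on_diff [intro]: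
  "smooth_on U f \<Longrightarrow> smooth_on U g \<Longrightarrow> smooth_on U (\<lambda>w. f w - g w)"
  using smooth_on_add[OF _ smooth_on_uminus, of U f g] by simp

lemma smooth_on_sum [intro]:
  "(\<And>i. i \<in> I \<Longrightarrow> smooth_on U (f i)) \<Longrightarrow> smooth_on U (\<lambda>w. \<Sum>i\<in>I. f i w)"
  by (induction I rule: infinite_finite_induct) auto

lemma smooth_on_prod [intro]:
  "(\<And>i. i \<in> I \<Longrightarrow> smooth_on U (f i)) \<Longrightarrow> smooth_on U (\<lambda>w. \<Prod>i\<in>I. f i w)"
  by (induction I rule: infinite_finite_induct) auto

section \<open>Calculus of the scalar Wirtinger derivatives\<close>

definition dw :: "(complex \<Rightarrow> complex) \<Rightarrow> complex \<Rightarrow> complex" where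
  "dw f w = (partial_x f w - \<i> * partial_y f w) / 2"

definition dwbar :: "(complex \<Rightarrow> complex) \<Rightarrow> complex \<Rightarrow> complex" where
  "dwbar f w = (partial_x f w + \<i> * partial_y f w) / 2"

lemma mat_dw_nth: "mat_dw F w $ i $ j = dw (\<lambda>v. F v $ i $ j) w"
  and mat_dwbar_nth: "mat_dwbar F w $ i $ j = dwbar (\<lambda>v. F v $ i $ j) w"
  by (simp_all add: mat_dw_def mat_dwbar_def dw_def dwbar_def)

text \<open>The directions 1 and \<open>\<i>\<close> give \<open>a + b\<close> and
  \<open>\<i> * (a - b)\<close> as partial derivatives, and the Wirtinger combinations solve for
  \<open>a\<close> and \<open>b\<close>. This links the total derivative with the definitions by
  partial derivatives.\<close>

lemma dw_dwbar_eqI: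
  assumes "(f has_derivative (\<lambda>h. a * h + b * cnj h)) (at w)"
  shows "dw f w = a" "dwbar f w = b"
proof -
  have along: "((\<lambda>t. f (w + c * of_real t)) has_vector_derivative a * c + b * cnj c) (at 0)" for c
  proof -
    have "((\<lambda>t::real. w + c * of_real t) has_derivative (\<lambda>t. c * of_real t)) (at 0)"
      by (auto intro!: derivative_eq_intros)
    from has_derivative_compose[OF this, of f "\<lambda>h. a * h + b * cnj h"] assms show ?thesis
      by (simp add: has_vector_derivative_def scaleR_conv_of_real algebra_simps)
  qed
  have partials: "partial_x f w = a + b" "partial_y f w = a * \<i> - b * \<i>"
    using along[of 1] along[of \<i>] by (simp_all add: partial_x_def partial_y_def vector_derivative_at)
  then show "dw f w = a" "dwbar f w = b"
    by (simp_all add: dw_def dwbar_def partials algebra_simps)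
qed

lemma smooth_on_has_derivative:
  assumes "smooth_on U f" "w \<in> U"
  shows "(f has_derivative (\<lambda>h. dw f w * h + dwbar f w * cnj h)) (at w)"
proof -
  have "times_differentiable 1 U f"
    using assms(1) by (simp only: smooth_on_def)
  then obtain a b where "(f has_derivative (\<lambda>h. a w * h + b w * cnj h)) (at w)"
    using assms(2) by auto
  with dw_dwbar_eqI[OF this] show ?thesis
    by simp
qed

text \<open>The witnesses may vary with the order \<open>k\<close>, but on \<open>U\<close> they
  must equal \<open>dw f\<close> and \<open>dwbar f\<close>, which do not depend on
  \<open>k\<close>.\<close>

lemma smooth_on_dw: "smooth_on U (dw f)"
  and smooth_on_dwbar: "smooth_on U (dwbar f)"
  if "open U" "smooth_on U f"
proof -
  have "times_differentiable k U (dw f) \<and> times_differentiable k U (dwbar f)" for k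
  proof -
    have "times_differentiable (Suc k) U f"
      using that(2) by (simp only: smooth_on_def)
    then obtain a b where ab: "\<forall>w\<in>U. (f has_derivative (\<lambda>h. a w * h + b w * cnj h)) (at w)"
      "times_differentiable k U a" "times_differentiable k U b"
      by auto
    from ab(1) have "\<And>w. w \<in> U \<Longrightarrow> a w = dw f w" "\<And>w. w \<in> U \<Longrightarrow> b w = dwbar f w"
      using dw_dwbar_eqI by metis+
    with ab that(1) times_differentiable_cong show ?thesis
      by metis
  qed
  then show "smooth_on U (dw f)" "smooth_on U (dwbar f)"
    by (simp_all add: smooth_on_def)
qed

lemma dw_dwbar_cong:
  assumes "open U" "w \<in> U" "smooth_on U f" "\<And>v. v \<in> U \<Longrightarrow> f v = g v"
  shows "dw g w = dw f w" "dwbar g w = dwbar f w"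
proof -
  have "(g has_derivative (\<lambda>h. dw f w * h + dwbar f w * cnj h)) (at w)"
    using smooth_on_has_derivative[OF assms(3,2)] assms(1,2,4)
    by (rule has_derivative_transform_within_open)
  then show "dw g w = dw f w" "dwbar g w = dwbar f w"
    by (rule dw_dwbar_eqI)+
qed

lemma dw_dwbar_add:
  assumes "smooth_on U f" "smooth_on U g" "w \<in> U"
  shows "dw (\<lambda>v. f v + g v) w = dw f w + dw g w"
    "dwbar (\<lambda>v. f v + g v) w = dwbar f w + dwbar g w"
proof -
  have "((\<lambda>v. f v + g v) has_derivative
      (\<lambda>h. (dw f w + dw g w) * h + (dwbar f w + dwbar g w) * cnj h)) (at w)"
    using has_derivative_add[OF smooth_on_has_derivative[OF assms(1,3)]
        smooth_on_has_derivative[OF assms(2,3)]]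
    by (simp add: algebra_simps)
  then show "dw (\<lambda>v. f v + g v) w = dw f w + dw g w"
    "dwbar (\<lambda>v. f v + g v) w = dwbar f w + dwbar g w"
    by (rule dw_dwbar_eqI)+
qed

lemma dw_dwbar_mult:
  assumes "smooth_on U f" "smooth_on U g" "w \<in> U"
  shows "dw (\<lambda>v. f v * g v) w = dw f w * g w + f w * dw g w"
    "dwbar (\<lambda>v. f v * g v) w = dwbar f w * g w + f w * dwbar g w"
proof -
  have "((\<lambda>v. f v * g v) has_derivative
      (\<lambda>h. (dw f w * g w + f w * dw g w) * h + (dwbar f w * g w + f w * dwbar g w) * cnj h)) (at w)"
    using has_derivative_mult[OF smooth_on_has_derivative[OF assms(1,3)]
        smooth_on_has_derivative[OF assms(2,3)]]
    by (simp add: algebra_simps)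
  then show "dw (\<lambda>v. f v * g v) w = dw f w * g w + f w * dw g w"
    "dwbar (\<lambda>v. f v * g v) w = dwbar f w * g w + f w * dwbar g w"
    by (rule dw_dwbar_eqI)+
qed

lemma dw_dwbar_const: "dw (\<lambda>v. c) w = 0" "dwbar (\<lambda>v. c) w = 0"
  by (rule dw_dwbar_eqI[where f = "\<lambda>v. c" and a = 0 and b = 0]; simp)+

section \<open>Smooth matrix-valued functions\<close>

definition mat_smooth_on :: "complex set \<Rightarrow> (complex \<Rightarrow> complex^'n^'m) \<Rightarrow> bool" where
  "mat_smooth_on U F \<longleftrightarrow> (\<forall>i j. smooth_on U (\<lambda>w. F w $ i $ j))"

lemma mat_smooth_on_const: "mat_smooth_on U (\<lambda>w. C)"
  and mat_smooth_on_add: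
    "mat_smooth_on U F \<Longrightarrow> mat_smooth_on U G \<Longrightarrow> mat_smooth_on U (\<lambda>w. F w + G w)"
  and mat_smooth_on_diff:
    "mat_smooth_on U F \<Longrightarrow> mat_smooth_on U G \<Longrightarrow> mat_smooth_on U (\<lambda>w. F w - G w)"
  and mat_smooth_on_uminus: "mat_smooth_on U F \<Longrightarrow> mat_smooth_on U (\<lambda>w. - F w)"
  by (auto simp: mat_smooth_on_def)

lemma mat_smooth_on_matrix_mult:
  "mat_smooth_on U F \<Longrightarrow> mat_smooth_on U G \<Longrightarrow> mat_smooth_on U (\<lambda>w. F w ** G w)"
  unfolding mat_smooth_on_def matrix_matrix_mult_def vec_lambda_beta
  by (intro allI smooth_on_sum smooth_on_mult) blast+

lemma mat_smooth_on_kronecker: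
  "mat_smooth_on U F \<Longrightarrow> mat_smooth_on U G \<Longrightarrow> mat_smooth_on U (\<lambda>w. F w \<otimes>\<^sub>K G w)"
  by (auto simp: mat_smooth_on_def kronecker_def)

lemma mat_smooth_on_mat_dw: "open U \<Longrightarrow> mat_smooth_on U F \<Longrightarrow> mat_smooth_on U (mat_dw F)"
  and mat_smooth_on_mat_dwbar: "open U \<Longrightarrow> mat_smooth_on U F \<Longrightarrow> mat_smooth_on U (mat_dwbar F)"
  by (simp_all add: mat_smooth_on_def mat_dw_nth mat_dwbar_nth smooth_on_dw smooth_on_dwbar)

lemma smooth_on_det: "mat_smooth_on U F \<Longrightarrow> smooth_on U (\<lambda>w. det (F w))"
  unfolding det_def mat_smooth_on_def
  by (intro smooth_on_sum smooth_on_mult smooth_on_const smooth_on_prod) blast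

lemma matrix_add_rdistrib: "(A + B) ** C = A ** C + B ** C"
  by (simp add: vec_eq_iff matrix_matrix_mult_def distrib_right sum.distrib)

lemma matrix_inv_right: "invertible A \<Longrightarrow> A ** matrix_inv A = mat 1"
  and matrix_inv_left: "invertible A \<Longrightarrow> matrix_inv A ** A = mat 1"
  unfolding invertible_def matrix_inv_def by (metis (mono_tags, lifting) someI_ex)+

lemma matrix_inv_eqI:
  assumes "A ** B = mat 1" "B ** A = mat 1"
  shows "matrix_inv A = B"
proof -
  have "invertible A"
    using assms by (auto simp: invertible_def)
  then have "matrix_inv A ** (A ** B) = B"
    by (simp add: matrix_mul_assoc matrix_inv_left)
  then show ?thesis
    by (simp add: assms)
qed

text \<open>By Cramer's rule each entry of the inverse is a quotient of determinants, and
  determinants are polynomials in smooth entries.\<close>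

lemma mat_smooth_on_matrix_inv:
  fixes F :: "complex \<Rightarrow> complex^'n^'n"
  assumes F: "mat_smooth_on U F" and U: "open U" and inv: "\<And>w. w \<in> U \<Longrightarrow> invertible (F w)"
  shows "mat_smooth_on U (\<lambda>w. matrix_inv (F w))"
  unfolding mat_smooth_on_def
proof (intro allI)
  fix j i
  \<comment> \<open>\<open>F w\<close> with column \<open>j\<close> replaced by the
    \<open>i\<close>-th basis vector: the numerator of Cramer's rule for component \<open>j\<close>
    of column \<open>i\<close> of the inverse.\<close>
  let ?M = "\<lambda>w. \<chi> a b. if b = j then axis i 1 $ a else F w $ a $ b"
  have det: "det (F w) \<noteq> 0" if "w \<in> U" for w
    using inv[OF that] invertible_det_nz by blast
  have entry: "det (?M w) * inverse (det (F w)) = matrix_inv (F w) $ j $ i" if "w \<in> U" for w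
  proof -
    have "F w *v (matrix_inv (F w) *v axis i 1) = axis i 1"
      using inv[OF that] by (simp add: matrix_vector_mul_assoc matrix_inv_right)
    then have "(matrix_inv (F w) *v axis i 1) $ j = det (?M w) / det (F w)"
      by (simp only: cramer[OF det[OF that]] vec_lambda_beta)
    moreover have "(matrix_inv (F w) *v axis i 1) $ j = matrix_inv (F w) $ j $ i"
      by (simp add: matrix_vector_mult_def axis_def if_distrib cong: if_cong)
    ultimately show ?thesis
      by (simp add: field_simps)
  qed
  have "smooth_on U (\<lambda>w. ?M w $ a $ b)" for a b
    using F by (cases "b = j") (auto simp: mat_smooth_on_def)
  then have "mat_smooth_on U ?M"
    unfolding mat_smooth_on_def by blast
  then have "smooth_on U (\<lambda>w. det (?M w) * inverse (det (F w)))"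
    by (intro smooth_on_mult smooth_on_inverse smooth_on_det F det)
  with U entry show "smooth_on U (\<lambda>w. matrix_inv (F w) $ j $ i)"
    by (rule smooth_on_cong)
qed

text \<open>Allows an identity between matrix functions known only on \<open>U\<close> to be
  differentiated there.\<close>

lemma mat_dw_cong:
  assumes "open U" "w \<in> U" "mat_smooth_on U F" "\<And>v. v \<in> U \<Longrightarrow> G v = F v"
  shows "mat_dw G w = mat_dw F w" "mat_dwbar G w = mat_dwbar F w"
  using assms unfolding mat_smooth_on_def
  by (auto simp: vec_eq_iff mat_dw_nth mat_dwbar_nth intro!: dw_dwbar_cong[of U])

lemma mat_dw_add:
  assumes "mat_smooth_on U F" "mat_smooth_on U G" "w \<in> U"
  shows "mat_dw (\<lambda>v. F v + G v) w = mat_dw F w + mat_dw G w"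
    "mat_dwbar (\<lambda>v. F v + G v) w = mat_dwbar F w + mat_dwbar G w"
  using assms
  by (auto simp: vec_eq_iff mat_dw_nth mat_dwbar_nth mat_smooth_on_def dw_dwbar_add[of U])

lemma mat_dw_kronecker:
  assumes "mat_smooth_on U F" "mat_smooth_on U G" "w \<in> U"
  shows "mat_dw (\<lambda>v. F v \<otimes>\<^sub>K G v) w = mat_dw F w \<otimes>\<^sub>K G w + F w \<otimes>\<^sub>K mat_dw G w"
    "mat_dwbar (\<lambda>v. F v \<otimes>\<^sub>K G v) w = mat_dwbar F w \<otimes>\<^sub>K G w + F w \<otimes>\<^sub>K mat_dwbar G w"
  using assms
  by (auto simp: vec_eq_iff mat_dw_nth mat_dwbar_nth mat_smooth_on_def kronecker_def
      dw_dwbar_mult[of U])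

lemma mat_dw_const: "mat_dw (\<lambda>v. C) w = 0" "mat_dwbar (\<lambda>v. C) w = 0"
  by (simp_all add: vec_eq_iff mat_dw_nth mat_dwbar_nth dw_dwbar_const)

section \<open>Kronecker products and sums\<close>

text \<open>The mixed-product rule: the sum over index pairs factors into two single sums.\<close>

lemma kronecker_mult: "(A \<otimes>\<^sub>K B) ** (C \<otimes>\<^sub>K D) = (A ** C) \<otimes>\<^sub>K (B ** D)"
  by (simp add: vec_eq_iff kronecker_def matrix_matrix_mult_def sum_product
      sum.cartesian_product case_prod_unfold mult_ac flip: UNIV_Times_UNIV)

lemma kronecker_add_left: "(A + B) \<otimes>\<^sub>K C = A \<otimes>\<^sub>K C + B \<otimes>\<^sub>K C"
  and kronecker_add_right: "A' \<otimes>\<^sub>K (B' + C') = A' \<otimes>\<^sub>K B' + A' \<otimes>\<^sub>K C'"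
  and kronecker_diff_left: "(A - B) \<otimes>\<^sub>K C = A \<otimes>\<^sub>K C - B \<otimes>\<^sub>K C"
  and kronecker_diff_right: "A' \<otimes>\<^sub>K (B' - C') = A' \<otimes>\<^sub>K B' - A' \<otimes>\<^sub>K C'"
  and kronecker_minus_left: "(- A) \<otimes>\<^sub>K C = - (A \<otimes>\<^sub>K C)"
  and kronecker_minus_right: "A' \<otimes>\<^sub>K (- B') = - (A' \<otimes>\<^sub>K B')"
  and kronecker_zero_left: "0 \<otimes>\<^sub>K C = 0"
  and kronecker_zero_right: "A' \<otimes>\<^sub>K 0 = 0"
  by (simp_all add: vec_eq_iff kronecker_def algebra_simps)

lemma kronecker_mat_1: "mat 1 \<otimes>\<^sub>K mat 1 = mat 1"
  by (auto simp: vec_eq_iff kronecker_def mat_def prod_eq_iff)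

lemma matrix_inv_kronecker:
  assumes "invertible A" "invertible B"
  shows "matrix_inv (A \<otimes>\<^sub>K B) = matrix_inv A \<otimes>\<^sub>K matrix_inv B"
  using assms
  by (intro matrix_inv_eqI)
    (simp_all add: kronecker_mult matrix_inv_left matrix_inv_right kronecker_mat_1)

text \<open>The Kronecker sum, by which a pair of endomorphisms acts on a tensor product as a
  derivation.\<close>

definition kronecker_sum :: "complex^'n^'n \<Rightarrow> complex^'m^'m \<Rightarrow> complex^('n \<times> 'm)^('n \<times> 'm)"
    (infixl \<open>\<oplus>\<^sub>K\<close> 65)
  where "A \<oplus>\<^sub>K B = A \<otimes>\<^sub>K mat 1 + mat 1 \<otimes>\<^sub>K B"

lemma kronecker_sum_add: "A \<oplus>\<^sub>K B + (C \<oplus>\<^sub>K D) = (A + C) \<oplus>\<^sub>K (B + D)"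
  by (simp add: kronecker_sum_def kronecker_add_left kronecker_add_right)

lemma kronecker_sum_uminus: "- (A \<oplus>\<^sub>K B) = (- A) \<oplus>\<^sub>K (- B)"
  by (simp add: kronecker_sum_def kronecker_minus_left kronecker_minus_right)

text \<open>The cross terms \<open>A \<otimes>\<^sub>K D\<close> and
  \<open>C \<otimes>\<^sub>K B\<close> occur in both products and cancel.\<close>

lemma kronecker_sum_commutator:
  "(A \<oplus>\<^sub>K B) ** (C \<oplus>\<^sub>K D) - (C \<oplus>\<^sub>K D) ** (A \<oplus>\<^sub>K B) = (A ** C - C ** A) \<oplus>\<^sub>K (B ** D - D ** B)"
  by (simp add: kronecker_sum_def matrix_add_ldistrib matrix_add_rdistrib kronecker_mult
      kronecker_diff_left kronecker_diff_right)

lemma mat_smooth_on_kronecker_sum: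
  "mat_smooth_on U F \<Longrightarrow> mat_smooth_on U G \<Longrightarrow> mat_smooth_on U (\<lambda>w. F w \<oplus>\<^sub>K G w)"
  unfolding kronecker_sum_def
  by (intro mat_smooth_on_add mat_smooth_on_kronecker mat_smooth_on_const)

text \<open>In the Leibniz rule for each summand, the term that differentiates the constant identity
  factor vanishes.\<close>

lemma mat_dw_kronecker_sum:
  assumes "mat_smooth_on U F" "mat_smooth_on U G" "w \<in> U"
  shows "mat_dw (\<lambda>v. F v \<oplus>\<^sub>K G v) w = mat_dw F w \<oplus>\<^sub>K mat_dw G w"
    "mat_dwbar (\<lambda>v. F v \<oplus>\<^sub>K G v) w = mat_dwbar F w \<oplus>\<^sub>K mat_dwbar G w"
  using assms unfolding kronecker_sum_def
  by (simp_all add: mat_dw_add[of U] mat_dw_kronecker[of U] mat_dw_const mat_smooth_on_const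
      mat_smooth_on_kronecker kronecker_zero_left kronecker_zero_right)

section \<open>Curvature of the tensor product\<close>

text \<open>A kernel vector gives a combination of the frame that is orthogonal to every frame
  vector, hence to itself. It is therefore zero, and independence makes its coefficients
  vanish.\<close>

lemma invertible_gram:
  fixes \<gamma> :: "'n::finite \<Rightarrow> complex \<Rightarrow> 'a::complex_hilbert"
  assumes "holomorphic_frame UNIV U E \<gamma>" "w \<in> U"
  shows "invertible (gram \<gamma> w)"
proof -
  have "x = 0" if x: "gram \<gamma> w *v x = 0" for x
  proof -
    let ?v = "\<Sum>j\<in>UNIV. x $ j *\<^sub>C \<gamma> j w"
    have "cinner ?v (\<gamma> i w) = 0" for i
    proof -
      have "cinner ?v (\<gamma> i w) = (gram \<gamma> w *v x) $ i"
        by (simp add: cinner_sum_left cinner_scaleC_left matrix_vector_mult_def gram_def mult.commute)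
      with x show ?thesis
        by simp
    qed
    then have "cinner ?v ?v = 0"
      by (subst cinner.sum_right) (simp add: cinner_scaleC_right)
    then have "?v = 0"
      by (rule cinner_eq_zeroD)
    moreover have "inj_on (\<lambda>s. \<gamma> s w) UNIV" "cvec.independent (range (\<lambda>s. \<gamma> s w))"
      using assms by (auto simp: holomorphic_frame_def)
    ultimately have "x $ j = 0" for j
      using frame_zero_combination[of UNIV "\<lambda>s. \<gamma> s w" "\<lambda>s. x $ s" j] by simp
    then show ?thesis
      by (simp add: vec_eq_iff)
  qed
  then show ?thesis
    unfolding invertible_left_inverse matrix_left_invertible_ker by blast
qed

lemma mat_smooth_on_gram:
  assumes "open U" "holomorphic_frame UNIV U E \<gamma>"
  shows "mat_smooth_on U (gram \<gamma>)"
  using assms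
  by (simp add: mat_smooth_on_def gram_def smooth_on_def holomorphic_frame_def
      times_differentiable_cinner)

lemma mat_smooth_on_connection_matrix:
  assumes "open U" "holomorphic_frame UNIV U E \<gamma>"
  shows "mat_smooth_on U (connection_matrix \<gamma>)"
  unfolding connection_matrix_def[abs_def]
  using assms invertible_gram[OF assms(2)]
  by (intro mat_smooth_on_matrix_mult mat_smooth_on_matrix_inv mat_smooth_on_mat_dw
      mat_smooth_on_gram)

lemma curvature_deriv_Cons:
  "curvature_deriv \<gamma> (d # ds) = cov_deriv \<gamma> d (curvature_deriv \<gamma> ds)"
  by (simp add: curvature_deriv_def)

text \<open>Supplies the smoothness needed to apply one more covariant derivative.\<close>

lemma mat_smooth_on_curvature_deriv:
  assumes "open U" "holomorphic_frame UNIV U E \<gamma>"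
  shows "mat_smooth_on U (curvature_deriv \<gamma> ds)"
proof (induction ds)
  case Nil
  have "curvature_deriv \<gamma> [] = (\<lambda>w. - mat_dwbar (connection_matrix \<gamma>) w)"
    by (auto simp: curvature_deriv_def curvature_def)
  with assms show ?case
    by (simp add: mat_smooth_on_uminus mat_smooth_on_mat_dwbar mat_smooth_on_connection_matrix)
next
  case (Cons d ds)
  with assms show ?case
    by (cases d) (simp_all add: curvature_deriv_Cons mat_smooth_on_add mat_smooth_on_diff mat_smooth_on_matrix_mult
        mat_smooth_on_mat_dw mat_smooth_on_mat_dwbar mat_smooth_on_connection_matrix)
qed

text \<open>Inner products of simple tensors are products of inner products, with pairs of indices
  as row and column labels.\<close>

lemma gram_tensor_frame:
  assumes "hilbert_tensor_product T"
  shows "gram (tensor_frame T e\<^sub>1 e\<^sub>2) w = gram e\<^sub>1 w \<otimes>\<^sub>K gram e\<^sub>2 w"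
  using assms
  by (simp add: vec_eq_iff gram_def tensor_frame_def kronecker_def hilbert_tensor_product_def)

text \<open>Multiplying the Leibniz expansion of the Gram matrix by its inverse, each summand keeps
  one connection matrix while the other factor cancels to the identity.\<close>

lemma connection_matrix_tensor_frame:
  fixes e\<^sub>1 :: "'n::finite \<Rightarrow> complex \<Rightarrow> 'a::complex_hilbert"
    and e\<^sub>2 :: "'m::finite \<Rightarrow> complex \<Rightarrow> 'b::complex_hilbert"
  assumes T: "hilbert_tensor_product T" and U: "open U" "w \<in> U"
    and e1: "holomorphic_frame UNIV U E\<^sub>1 e\<^sub>1" and e2: "holomorphic_frame UNIV U E\<^sub>2 e\<^sub>2"
  shows "connection_matrix (tensor_frame T e\<^sub>1 e\<^sub>2) w =
    connection_matrix e\<^sub>1 w \<oplus>\<^sub>K connection_matrix e\<^sub>2 w"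
proof -
  have "gram (tensor_frame T e\<^sub>1 e\<^sub>2) = (\<lambda>w. gram e\<^sub>1 w \<otimes>\<^sub>K gram e\<^sub>2 w)"
    by (simp add: fun_eq_iff gram_tensor_frame[OF T])
  moreover note inv = invertible_gram[OF e1 U(2)] invertible_gram[OF e2 U(2)]
  ultimately show ?thesis
    using mat_dw_kronecker(1)[OF mat_smooth_on_gram[OF U(1) e1] mat_smooth_on_gram[OF U(1) e2] U(2)]
    by (simp add: connection_matrix_def kronecker_sum_def matrix_inv_kronecker matrix_add_ldistrib
        kronecker_mult matrix_inv_left)
qed

lemma curvature_deriv_tensor_frame:
  fixes e\<^sub>1 :: "'n::finite \<Rightarrow> complex \<Rightarrow> 'a::complex_hilbert"
    and e\<^sub>2 :: "'m::finite \<Rightarrow> complex \<Rightarrow> 'b::complex_hilbert"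
  assumes T: "hilbert_tensor_product T" and U: "open U"
    and e1: "holomorphic_frame UNIV U E\<^sub>1 e\<^sub>1" and e2: "holomorphic_frame UNIV U E\<^sub>2 e\<^sub>2"
    and w: "w \<in> U"
  shows "curvature_deriv (tensor_frame T e\<^sub>1 e\<^sub>2) ds w =
    curvature_deriv e\<^sub>1 ds w \<oplus>\<^sub>K curvature_deriv e\<^sub>2 ds w"
  using w
\<comment> \<open>The point is generalised because the induction hypothesis gets differentiated,
  which requires it on all of \<open>U\<close>.\<close>
proof (induction ds arbitrary: w)
  case Nil
  note smooth = mat_smooth_on_connection_matrix[OF U e1] mat_smooth_on_connection_matrix[OF U e2]
  have "mat_dwbar (connection_matrix (tensor_frame T e\<^sub>1 e\<^sub>2)) w =
      mat_dwbar (\<lambda>w. connection_matrix e\<^sub>1 w \<oplus>\<^sub>K connection_matrix e\<^sub>2 w) w"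
    using connection_matrix_tensor_frame[OF T U _ e1 e2]
    by (intro mat_dw_cong(2)[OF U Nil] mat_smooth_on_kronecker_sum smooth)
  then show ?case
    by (simp add: curvature_deriv_def curvature_def mat_dw_kronecker_sum(2)[OF smooth Nil]
        kronecker_sum_uminus)
next
  case (Cons d ds)
  let ?K = "curvature_deriv (tensor_frame T e\<^sub>1 e\<^sub>2) ds"
    and ?K\<^sub>1 = "curvature_deriv e\<^sub>1 ds" and ?K\<^sub>2 = "curvature_deriv e\<^sub>2 ds"
  note smooth = mat_smooth_on_curvature_deriv[OF U e1, of ds]
    mat_smooth_on_curvature_deriv[OF U e2, of ds]
  have "mat_dw ?K w = mat_dw (\<lambda>w. ?K\<^sub>1 w \<oplus>\<^sub>K ?K\<^sub>2 w) w"
    "mat_dwbar ?K w = mat_dwbar (\<lambda>w. ?K\<^sub>1 w \<oplus>\<^sub>K ?K\<^sub>2 w) w"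
    by (intro mat_dw_cong[OF U Cons.prems] mat_smooth_on_kronecker_sum smooth Cons.IH; assumption)+
  then have "mat_dw ?K w = mat_dw ?K\<^sub>1 w \<oplus>\<^sub>K mat_dw ?K\<^sub>2 w"
    "mat_dwbar ?K w = mat_dwbar ?K\<^sub>1 w \<oplus>\<^sub>K mat_dwbar ?K\<^sub>2 w"
    by (simp_all add: mat_dw_kronecker_sum[OF smooth Cons.prems])
  \<comment> \<open>For \<open>Dzbar\<close> the derivative alone decides; for \<open>Dz\<close> the
    commutator with the connection matrix splits as well.\<close>
  with Cons show ?case
    by (cases d) (simp_all add: curvature_deriv_Cons connection_matrix_tensor_frame[OF T U _ e1 e2]
        kronecker_sum_commutator kronecker_sum_add)
qed

theorem corollary4p8:
  fixes \<Omega> U :: "complex set"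
    and E\<^sub>1 :: "complex \<Rightarrow> 'a::complex_hilbert set"
    and E\<^sub>2 :: "complex \<Rightarrow> 'b::complex_hilbert set"
    and T :: "'a \<Rightarrow> 'b \<Rightarrow> 'c::complex_hilbert"
    and e\<^sub>1 :: "'n::finite \<Rightarrow> complex \<Rightarrow> 'a"
    and e\<^sub>2 :: "'m::finite \<Rightarrow> complex \<Rightarrow> 'b"
  assumes "open \<Omega>" and "connected \<Omega>"
    and "hermitian_holomorphic_bundle \<Omega> CARD('n) E\<^sub>1"
    and "hermitian_holomorphic_bundle \<Omega> CARD('m) E\<^sub>2"
    and "hilbert_tensor_product T"
    and "open U" and "U \<subseteq> \<Omega>"
    and "holomorphic_frame UNIV U E\<^sub>1 e\<^sub>1"
    and "holomorphic_frame UNIV U E\<^sub>2 e\<^sub>2"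
  shows "\<forall>i j. \<forall>ds \<in> derivative_orders i j. \<forall>w \<in> U.
           curvature_deriv (tensor_frame T e\<^sub>1 e\<^sub>2) ds w =
             curvature_deriv e\<^sub>1 ds w \<otimes>\<^sub>K (mat 1 :: complex^'m^'m) +
             (mat 1 :: complex^'n^'n) \<otimes>\<^sub>K curvature_deriv e\<^sub>2 ds w"
  \<comment> \<open>The identity holds word by word, hence for each ordering of \<open>i\<close>
    letters \<open>Dz\<close> and \<open>j\<close> letters \<open>Dzbar\<close>.\<close>
  using curvature_deriv_tensor_frame[OF assms(5,6,8,9)] by (simp add: kronecker_sum_def)

end
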